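(* Let $b$ be even and $a\ge b\ge 2$. If the spider $S(a,b,1)$ is $e$-positive, then: (1) if $b\equiv 2\pmod 3$, then either $a\equiv 0\pmod 3$ and $a\le 2b+2$, or $a\equiv1\pmod 3$ and $a\le 2b-3$ (in particular $a\not\equiv 2\pmod 3$); (2) if $b\not\equiv 2\pmod 3$, then $a\le b^2-1$ or $a=b^2+b$; (3) if $a$ is even, then $a>b+\frac{1+\sqrt{8b-3}}{2}$. *)

theory Defs
  imports Complex_Main "HOL-Library.FuncSet"
begin

text \<open>Graphs are given by a finite vertex set V and a symmetric adjacency relation E.
Colours are natural numbers; a monomial x^alpha of the (infinitely many variable)
formal power series ring is an exponent vector alpha :: nat => nat.
Formal power series are represented by their coefficient functions.\<close>

definition proper_colorings :: "'v set \<Rightarrow> ('v \<Rightarrow> 'v \<Rightarrow> bool) \<Rightarrow> ('v \<Rightarrow> nat) set" where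
  "proper_colorings V E =
     {\<kappa> \<in> V \<rightarrow>\<^sub>E (UNIV :: nat set). \<forall>u\<in>V. \<forall>v\<in>V. E u v \<longrightarrow> \<kappa> u \<noteq> \<kappa> v}"

text \<open>Coefficient of x^alpha in the chromatic symmetric function
X_G = sum over proper colourings kappa of prod_v x_(kappa v).\<close>
definition chrom_sym_coeff :: "'v set \<Rightarrow> ('v \<Rightarrow> 'v \<Rightarrow> bool) \<Rightarrow> (nat \<Rightarrow> nat) \<Rightarrow> nat" where
  "chrom_sym_coeff V E \<alpha> =
     card {\<kappa> \<in> proper_colorings V E. \<forall>c. card {v \<in> V. \<kappa> v = c} = \<alpha> c}"

text \<open>Coefficient of x^alpha in e_mu = e_(mu_1) * ... * e_(mu_l), where
e_k = sum over k-element sets S of colours of prod_(c in S) x_c.\<close>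
definition elem_sym_coeff :: "nat list \<Rightarrow> (nat \<Rightarrow> nat) \<Rightarrow> nat" where
  "elem_sym_coeff \<mu> \<alpha> =
     card {Ss :: nat set list. length Ss = length \<mu> \<and>
              (\<forall>i < length \<mu>. finite (Ss ! i) \<and> card (Ss ! i) = \<mu> ! i) \<and>
              (\<forall>c. card {i. i < length \<mu> \<and> c \<in> Ss ! i} = \<alpha> c)}"

definition partitions_of :: "nat \<Rightarrow> nat list set" where
  "partitions_of n = {\<mu>. sorted_wrt (\<ge>) \<mu> \<and> 0 \<notin> set \<mu> \<and> sum_list \<mu> = n}"

text \<open>X_G is e-positive: X_G = sum_mu d_mu e_mu with all d_mu >= 0
(X_G is homogeneous of degree |V|, so only partitions of |V| occur).\<close>
definition e_positive :: "'v set \<Rightarrow> ('v \<Rightarrow> 'v \<Rightarrow> bool) \<Rightarrow> bool" where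
  "e_positive V E \<longleftrightarrow>
     (\<exists>d :: nat list \<Rightarrow> real. (\<forall>\<mu>. d \<mu> \<ge> 0) \<and>
        (\<forall>\<alpha>. real (chrom_sym_coeff V E \<alpha>) =
              (\<Sum>\<mu>\<in>partitions_of (card V). d \<mu> * real (elem_sym_coeff \<mu> \<alpha>))))"

text \<open>The spider S(a,b,c): centre 0 with three legs (paths) of a, b, c vertices:
leg 1 = 1..a, leg 2 = a+1..a+b, leg 3 = a+b+1..a+b+c; the centre is adjacent
to the first vertex of each leg.\<close>
definition spider_vertices :: "nat \<Rightarrow> nat \<Rightarrow> nat \<Rightarrow> nat set" where
  "spider_vertices a b c = {0..a+b+c}"

definition spider_edge :: "nat \<Rightarrow> nat \<Rightarrow> nat \<Rightarrow> nat \<Rightarrow> nat \<Rightarrow> bool" where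
  "spider_edge a b c u v \<longleftrightarrow>
     (u = 0 \<and> ((v = 1 \<and> 1 \<le> a) \<or> (v = a + 1 \<and> 1 \<le> b) \<or> (v = a + b + 1 \<and> 1 \<le> c))) \<or>
     (v = u + 1 \<and> 1 \<le> u \<and> u \<noteq> a \<and> u \<noteq> a + b \<and> v \<le> a + b + c)"

definition spider_adj :: "nat \<Rightarrow> nat \<Rightarrow> nat \<Rightarrow> nat \<Rightarrow> nat \<Rightarrow> bool" where
  "spider_adj a b c u v \<longleftrightarrow> spider_edge a b c u v \<or> spider_edge a b c v u"

end

theory Submission
  imports
    Defs
    "HOL-Computational_Algebra.Formal_Power_Series"
    "HOL-Computational_Algebra.Fundamental_Theorem_Algebra"
begin

text \<open>By the fundamental theorem of algebra there are complex numbers at which the elementary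
  symmetric polynomials \<open>e\<^sub>k\<close> take prescribed values; hence a nonnegative \<open>e\<close>-expansion stays
  coefficientwise nonnegative when the \<open>e\<^sub>k\<close> are replaced by polynomials with nonnegative
  coefficients. Summing over colourings leg by leg gives
  \<open>X(S(a,b,1)) = X(P\<^bsub>a+b+2\<^esub>) + e\<^sub>1 X(P\<^bsub>a+b+1\<^esub>) - X(P\<^bsub>a+1\<^esub>) X(P\<^bsub>b+1\<^esub>)\<close>, and the \<open>e\<close>-expansion of
  paths has the generating function \<open>E(t) / (E(t) - t E'(t))\<close>. Each excluded pair \<open>(a, b)\<close> is then
  ruled out by one negative coefficient: with \<open>M = 3\<close> in (1) and \<open>M = b + 1\<close> in (2), that of
  \<open>e\<^sub>M \<cdots> e\<^sub>M\<close> or of \<open>e\<^sub>m e\<^sub>M \<cdots> e\<^sub>M\<close> for some \<open>m\<close> not divisible by \<open>M\<close>; in (3), that of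
  \<open>e\<^sub>3 e\<^sub>3 e\<^sub>2 \<cdots> e\<^sub>2\<close>.\<close>

section \<open>Elementary symmetric polynomials at a point\<close>

definition esym :: "nat \<Rightarrow> (nat \<Rightarrow> 'a::comm_ring_1) \<Rightarrow> nat \<Rightarrow> 'a" where
  "esym N x k = (\<Sum>S | S \<subseteq> {..<N} \<and> card S = k. \<Prod>c\<in>S. x c)"

text \<open>Expand over the set S of factors that contribute \<open>f (x i)\<close> and group by
  \<open>card S\<close>. The ring homomorphism \<open>f\<close> lets one expansion serve polynomials
  (constants embedded, \<open>y\<close> the indeterminate) and power series (\<open>f\<close> the
  identity, \<open>y = 1\<close>).\<close>

lemma prod_const_add_esym:
  fixes x :: "nat \<Rightarrow> 'a::comm_ring_1" and f :: "'a \<Rightarrow> 'b::comm_ring_1"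
  assumes "f 0 = 0" "f 1 = 1" "\<And>u v. f (u + v) = f u + f v" "\<And>u v. f (u * v) = f u * f v"
  shows "(\<Prod>i<N. f (x i) + y) = (\<Sum>k\<le>N. f (esym N x k) * y ^ (N - k))"
proof -
  have fsum: "f (sum h A) = (\<Sum>a\<in>A. f (h a))" for h and A :: "nat set set"
    by (induction A rule: infinite_finite_induct) (simp_all add: assms)
  have fprod: "f (prod h A) = (\<Prod>a\<in>A. f (h a))" for h and A :: "nat set"
    by (induction A rule: infinite_finite_induct) (simp_all add: assms)
  have "(\<Prod>i<N. f (x i) + y) = (\<Sum>S\<in>Pow {..<N}. (\<Prod>c\<in>S. f (x c)) * y ^ (N - card S))"
    unfolding prod_add[OF finite_lessThan]
    by (intro sum.cong refl) (auto simp: card_Diff_subset finite_subset)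
  also have "\<dots> = (\<Sum>k\<le>N. \<Sum>S | S \<in> Pow {..<N} \<and> card S = k. (\<Prod>c\<in>S. f (x c)) * y ^ (N - card S))"
    by (rule sum.group[symmetric]) (auto intro: order_trans[OF card_mono[of "{..<N}"]])
  also have "\<dots> = (\<Sum>k\<le>N. f (esym N x k) * y ^ (N - k))"
    by (intro sum.cong refl) (simp add: esym_def fsum fprod sum_distrib_right)
  finally show ?thesis .
qed

lemma esym_0 [simp]: "esym N x 0 = 1"
proof -
  have "{S. S \<subseteq> {..<N} \<and> card S = 0} = {{}}"
    by (auto simp: finite_subset)
  then show ?thesis by (simp add: esym_def)
qed

lemma esym_eq_0: "N < k \<Longrightarrow> esym N x k = 0"
proof -
  assume "N < k"
  then have "\<not> (S \<subseteq> {..<N} \<and> card S = k)" for S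
    using card_mono[of "{..<N}" S] by auto
  then have "{S. S \<subseteq> {..<N} \<and> card S = k} = {}" by blast
  then show ?thesis by (simp only: esym_def sum.empty)
qed

lemma esym_1: "esym N x (Suc 0) = (\<Sum>i<N. x i)"
proof -
  have "{S. S \<subseteq> {..<N} \<and> card S = Suc 0} = (\<lambda>i. {i}) ` {..<N}"
    by (auto simp: card_Suc_eq)
  then show ?thesis by (simp add: esym_def sum.reindex)
qed

lemma prod_add_const_esym:
  fixes x :: "nat \<Rightarrow> 'a::comm_ring_1"
  shows "(\<Prod>i<N. [:x i, 1:]) = (\<Sum>k\<le>N. monom (esym N x k) (N - k))"
proof -
  have "(\<Prod>i<N. [:x i:] + [:0, 1:]) = (\<Sum>k\<le>N. [:esym N x k:] * [:0, 1:] ^ (N - k))"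
    by (rule prod_const_add_esym) simp_all
  then show ?thesis by (simp add: monom_altdef)
qed

lemma prod_one_plus_esym:
  fixes x :: "nat \<Rightarrow> 'a::comm_ring_1"
  shows "(\<Prod>i<N. 1 + fps_const (x i) * fps_X) = Abs_fps (esym N x)"
proof (rule fps_ext)
  fix n
  have *: "esym N (\<lambda>i. fps_const (x i) * fps_X) k = fps_const (esym N x k) * fps_X ^ k" for k
  proof -
    have fsum: "fps_const (sum h A) = (\<Sum>a\<in>A. fps_const (h a))" for h :: "nat set \<Rightarrow> 'a" and A
      by (induction A rule: infinite_finite_induct) (simp_all flip: fps_const_add)
    have fprod: "fps_const (prod h A) = (\<Prod>a\<in>A. fps_const (h a))" for h :: "nat \<Rightarrow> 'a" and A
      by (induction A rule: infinite_finite_induct) (simp_all flip: fps_const_mult)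
    show ?thesis
      by (simp add: esym_def fsum fprod sum_distrib_right prod.distrib)
  qed
  have "(\<Prod>i<N. 1 + fps_const (x i) * fps_X) = (\<Prod>i<N. fps_const (x i) * fps_X + 1)"
    by (simp add: add.commute)
  also have "\<dots> = (\<Sum>k\<le>N. fps_const (esym N x k) * fps_X ^ k)"
    using prod_const_add_esym[where f = "\<lambda>u. u" and x = "\<lambda>i. fps_const (x i) * fps_X" and y = 1 and N = N]
    by (simp add: *)
  finally show "fps_nth (\<Prod>i<N. 1 + fps_const (x i) * fps_X) n = fps_nth (Abs_fps (esym N x)) n"
    by (auto simp: fps_sum_nth fps_X_power_nth esym_eq_0 if_distrib if_distribR cong: if_cong)
qed

lemma coeff_sum_monom_diff:
  fixes w :: "nat \<Rightarrow> 'a::comm_monoid_add"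
  assumes "k \<le> N"
  shows "coeff (\<Sum>j\<le>N. monom (w j) (N - j)) (N - k) = w k"
proof -
  have "coeff (\<Sum>j\<le>N. monom (w j) (N - j)) (N - k) = (\<Sum>j\<le>N. if j = k then w j else 0)"
    unfolding coeff_sum coeff_monom using assms by (intro sum.cong) auto
  then show ?thesis using assms by simp
qed

text \<open>Vieta: the prescribed values are the coefficients of a monic polynomial, which splits
  over the complex numbers; the negated roots form the required point.\<close>

lemma esym_surj:
  fixes z :: "nat \<Rightarrow> complex"
  obtains x where "\<And>k. 1 \<le> k \<Longrightarrow> k \<le> N \<Longrightarrow> esym N x k = z k"
proof -
  \<comment> \<open>Index 0 is overridden by 1 to make the polynomial monic of degree
    \<open>N\<close>, whatever \<open>z 0\<close> is.\<close>
  define w where "w k = (if k = 0 then 1 else z k)" for k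
  define p where "p = (\<Sum>k\<le>N. monom (w k) (N - k))"
  have coeff_p: "coeff p (N - k) = w k" if "k \<le> N" for k
    using that unfolding p_def by (rule coeff_sum_monom_diff)
  have "degree p \<le> N"
    unfolding p_def by (rule degree_sum_le) (auto intro: order_trans[OF degree_monom_le])
  moreover have "coeff p N = 1" using coeff_p[of 0] by (simp add: w_def)
  ultimately have deg: "degree p = N" and lead: "lead_coeff p = 1" 
    by (metis le_degree le_antisym zero_neq_one)+
  then have "p \<noteq> 0" by auto
  from alg_closed_imp_factorization[OF this] deg lead obtain A where
    A: "size A = N" "p = (\<Prod>x\<in>#A. [:-x, 1:])" by auto
  obtain xs where xs: "mset xs = A" using ex_mset by blast
  define x where "x i = - (xs ! i)" for i
  have "p = (\<Prod>i<N. [:x i, 1:])"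
    using A by (auto simp: x_def prod.list_conv_set_nth atLeast0LessThan prod_mset_prod_list
        simp flip: xs mset_map)
  then have "p = (\<Sum>k\<le>N. monom (esym N x k) (N - k))"
    by (simp only: prod_add_const_esym)
  then have "esym N x k = w k" if "k \<le> N" for k
    using coeff_p[OF that] coeff_sum_monom_diff[OF that, of "esym N x"] by simp
  then show ?thesis by (intro that[of x]) (simp add: w_def)
qed

section \<open>Evaluating coefficient identities\<close>

lemma prod_power_card:
  fixes x :: "nat \<Rightarrow> 'a::comm_ring_1"
  assumes "finite A" "finite C"
  shows "(\<Prod>a\<in>A. \<Prod>c\<in>C. if R a c then x c else 1) = (\<Prod>c\<in>C. x c ^ card {a\<in>A. R a c})"
proof -
  have "(\<Prod>a\<in>A. if R a c then x c else 1) = x c ^ card {a\<in>A. R a c}" for c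
    using assms by (subst prod.inter_filter[symmetric]) simp_all
  then show ?thesis by (subst prod.swap) simp
qed

text \<open>A finite box of exponent vectors: it contains every monomial of degree at most
  \<open>B\<close> in the first \<open>N\<close> variables, so coefficient functions can be
  summed.\<close>

definition exps :: "nat \<Rightarrow> nat \<Rightarrow> (nat \<Rightarrow> nat) set" where
  "exps N B = {\<alpha>. \<forall>c. (c \<in> {..<N} \<longrightarrow> \<alpha> c \<in> {..B}) \<and> (c \<notin> {..<N} \<longrightarrow> \<alpha> c = 0)}"

lemma finite_exps [simp]: "finite (exps N B)"
  unfolding exps_def by (rule finite_set_of_finite_funs) simp_all

text \<open>This is \<open>X_G\<close> evaluated at \<open>x\<close>, with all variables of index at
  least \<open>N\<close> set to 0.\<close>

definition color_sum :: "'v set \<Rightarrow> ('v \<Rightarrow> 'v \<Rightarrow> bool) \<Rightarrow> nat \<Rightarrow> (nat \<Rightarrow> 'a::comm_ring_1) \<Rightarrow> 'a" where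
  "color_sum V E N x =
     (\<Sum>\<kappa> | \<kappa> \<in> V \<rightarrow>\<^sub>E {..<N} \<and> (\<forall>u\<in>V. \<forall>v\<in>V. E u v \<longrightarrow> \<kappa> u \<noteq> \<kappa> v). \<Prod>v\<in>V. x (\<kappa> v))"

text \<open>Generating-function bookkeeping: group the objects \<kappa> by their exponent vector
  \<open>ty \<kappa>\<close>. It is applied once to colourings and once to tuples of colour
  sets.\<close>

lemma sum_exps_eq:
  fixes x :: "nat \<Rightarrow> 'a::comm_ring_1"
  assumes "finite K" and "\<And>\<kappa>. \<kappa> \<in> K \<Longrightarrow> ty \<kappa> \<in> exps N B"
    and "\<And>\<kappa>. \<kappa> \<in> K \<Longrightarrow> h \<kappa> = (\<Prod>c<N. x c ^ ty \<kappa> c)"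
    and "\<And>\<alpha>. \<alpha> \<in> exps N B \<Longrightarrow> n \<alpha> = card {\<kappa> \<in> K. ty \<kappa> = \<alpha>}"
  shows "(\<Sum>\<alpha>\<in>exps N B. of_nat (n \<alpha>) * (\<Prod>c<N. x c ^ \<alpha> c)) = (\<Sum>\<kappa>\<in>K. h \<kappa>)"
proof -
  have "(\<Sum>\<kappa>\<in>K. h \<kappa>) = (\<Sum>\<alpha>\<in>exps N B. \<Sum>\<kappa> | \<kappa> \<in> K \<and> ty \<kappa> = \<alpha>. h \<kappa>)"
    using assms by (intro sum.group[symmetric]) auto
  also have "\<dots> = (\<Sum>\<alpha>\<in>exps N B. of_nat (n \<alpha>) * (\<Prod>c<N. x c ^ \<alpha> c))"
  proof (intro sum.cong refl)
    fix \<alpha> assume \<alpha>: "\<alpha> \<in> exps N B"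
    have "(\<Sum>\<kappa> | \<kappa> \<in> K \<and> ty \<kappa> = \<alpha>. h \<kappa>) = (\<Sum>\<kappa> | \<kappa> \<in> K \<and> ty \<kappa> = \<alpha>. \<Prod>c<N. x c ^ \<alpha> c)"
      by (intro sum.cong refl) (auto simp: assms)
    then show "(\<Sum>\<kappa> | \<kappa> \<in> K \<and> ty \<kappa> = \<alpha>. h \<kappa>) = of_nat (n \<alpha>) * (\<Prod>c<N. x c ^ \<alpha> c)"
      using assms(4)[OF \<alpha>] by simp
  qed
  finally show ?thesis by simp
qed

lemma sum_chrom_sym_coeff:
  fixes x :: "nat \<Rightarrow> 'a::comm_ring_1"
  assumes V: "finite V" "card V \<le> B"
  shows "(\<Sum>\<alpha>\<in>exps N B. of_nat (chrom_sym_coeff V E \<alpha>) * (\<Prod>c<N. x c ^ \<alpha> c)) = color_sum V E N x"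
  unfolding color_sum_def
proof (rule sum_exps_eq[where ty = "\<lambda>\<kappa> c. card {v \<in> V. \<kappa> v = c}"])
  let ?K = "{\<kappa> \<in> V \<rightarrow>\<^sub>E {..<N}. \<forall>u\<in>V. \<forall>v\<in>V. E u v \<longrightarrow> \<kappa> u \<noteq> \<kappa> v}"
  show "finite ?K"
    by (rule finite_subset[of _ "V \<rightarrow>\<^sub>E {..<N}"]) (use V in \<open>auto intro: finite_PiE\<close>)
  fix \<kappa> assume \<kappa>: "\<kappa> \<in> ?K"
  have "card {v \<in> V. \<kappa> v = c} \<le> B" for c
    using V by (intro order_trans[OF card_mono V(2)]) auto
  moreover have "card {v \<in> V. \<kappa> v = c} = 0" if "c \<notin> {..<N}" for c
  proof -
    have "{v \<in> V. \<kappa> v = c} = {}" using \<kappa> that by (auto dest: PiE_mem)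
    then show ?thesis by (simp only: card.empty)
  qed
  ultimately show "(\<lambda>c. card {v \<in> V. \<kappa> v = c}) \<in> exps N B"
    by (auto simp: exps_def)
  have "(\<Prod>v\<in>V. x (\<kappa> v)) = (\<Prod>v\<in>V. \<Prod>c<N. if \<kappa> v = c then x c else 1)"
    using \<kappa> by (intro prod.cong refl) (auto dest: PiE_mem)
  then show "(\<Prod>v\<in>V. x (\<kappa> v)) = (\<Prod>c<N. x c ^ card {v \<in> V. \<kappa> v = c})"
    using V by (simp only: prod_power_card finite_lessThan)
next
  fix \<alpha> assume \<alpha>: "\<alpha> \<in> exps N B"
  \<comment> \<open>Vectors in the box vanish from \<open>N\<close> on, so a colouring of that type
    uses only colours below \<open>N\<close>; the unbounded colour set thus does no harm.\<close>
  have "\<kappa> v < N" if "v \<in> V" "\<forall>c. card {v \<in> V. \<kappa> v = c} = \<alpha> c" for \<kappa> v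
  proof (rule ccontr)
    assume "\<not> \<kappa> v < N"
    then have "\<alpha> (\<kappa> v) = 0" using \<alpha> by (auto simp: exps_def)
    then have "card {u \<in> V. \<kappa> u = \<kappa> v} = 0" using that by simp
    then show False using V that(1) by auto
  qed
  then show "chrom_sym_coeff V E \<alpha> = card {\<kappa> \<in> {\<kappa> \<in> V \<rightarrow>\<^sub>E {..<N}. \<forall>u\<in>V. \<forall>v\<in>V. E u v \<longrightarrow> \<kappa> u \<noteq> \<kappa> v}.
        (\<lambda>c. card {v \<in> V. \<kappa> v = c}) = \<alpha>}"
    unfolding chrom_sym_coeff_def proper_colorings_def
    by (intro arg_cong[where f = card]) (auto simp: PiE_def Pi_def)
qed

section \<open>Products of elementary symmetric polynomials as sums over tuples of sets\<close>

lemma listset_conv_nth: "listset As = {xs. length xs = length As \<and> (\<forall>i<length As. xs ! i \<in> As ! i)}"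
proof (induction As)
  case (Cons A As)
  have "length xs = Suc (length As) \<and> (\<forall>i<Suc (length As). xs ! i \<in> (A # As) ! i) \<longleftrightarrow>
      (\<exists>y ys. xs = y # ys \<and> y \<in> A \<and> length ys = length As \<and> (\<forall>i<length As. ys ! i \<in> As ! i))" for xs
    by (cases xs) (auto simp: All_less_Suc2)
  then show ?case by (auto simp: set_Cons_def Cons)
qed auto

lemma finite_listset: "(\<And>A. A \<in> set As \<Longrightarrow> finite A) \<Longrightarrow> finite (listset As)"
proof (induction As)
  case (Cons A As)
  have "set_Cons A (listset As) = (\<lambda>(y, ys). y # ys) ` (A \<times> listset As)"
    by (auto simp: set_Cons_def)
  then show ?case using Cons by auto
qed auto

lemma sum_listset_prod_list:
  fixes f :: "'b \<Rightarrow> 'a::comm_ring_1"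
  shows "(\<Sum>xs\<in>listset As. prod_list (map f xs)) = prod_list (map (sum f) As)"
proof (induction As)
  case (Cons A As)
  have "(\<Sum>xs\<in>listset (A # As). prod_list (map f xs)) =
      (\<Sum>(y, ys)\<in>A \<times> listset As. f y * prod_list (map f ys))"
    by (rule sum.reindex_bij_witness[of _ "\<lambda>(y, ys). y # ys" "\<lambda>xs. (hd xs, tl xs)"])
      (auto simp: set_Cons_def)
  also have "\<dots> = sum f A * (\<Sum>ys\<in>listset As. prod_list (map f ys))"
    by (simp add: sum_product sum.cartesian_product)
  finally show ?case by (simp add: Cons)
qed auto

lemma sum_elem_sym_coeff:
  fixes x :: "nat \<Rightarrow> 'a::comm_ring_1"
  assumes "length \<mu> \<le> B"
  shows "(\<Sum>\<alpha>\<in>exps N B. of_nat (elem_sym_coeff \<mu> \<alpha>) * (\<Prod>c<N. x c ^ \<alpha> c)) = prod_list (map (esym N x) \<mu>)"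
proof -
  define As where "As = map (\<lambda>k. {S. S \<subseteq> {..<N} \<and> card S = k}) \<mu>"
  have [simp]: "length As = length \<mu>" by (simp add: As_def)
  have mem: "Ss \<in> listset As \<longleftrightarrow> length Ss = length \<mu> \<and>
      (\<forall>i<length \<mu>. Ss ! i \<subseteq> {..<N} \<and> card (Ss ! i) = \<mu> ! i)" for Ss
    by (auto simp: listset_conv_nth As_def)
  have "(\<Sum>\<alpha>\<in>exps N B. of_nat (elem_sym_coeff \<mu> \<alpha>) * (\<Prod>c<N. x c ^ \<alpha> c)) =
      (\<Sum>Ss\<in>listset As. prod_list (map (\<lambda>S. \<Prod>c\<in>S. x c) Ss))"
  proof (rule sum_exps_eq[where ty = "\<lambda>Ss c. card {i. i < length \<mu> \<and> c \<in> Ss ! i}"])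
    show "finite (listset As)"
      by (rule finite_listset) (auto simp: As_def intro: finite_subset[of _ "Pow {..<N}"])
    fix Ss assume Ss: "Ss \<in> listset As"
    \<comment> \<open>A colour occurs at most once in each set, so its exponent is at most the
      number of parts.\<close>
    have "card {i. i < length \<mu> \<and> c \<in> Ss ! i} \<le> B" for c
      using card_mono[of "{..<length \<mu>}" "{i. i < length \<mu> \<and> c \<in> Ss ! i}"] assms by fastforce
    moreover have "card {i. i < length \<mu> \<and> c \<in> Ss ! i} = 0" if "c \<notin> {..<N}" for c
    proof -
      have "{i. i < length \<mu> \<and> c \<in> Ss ! i} = {}" using Ss that by (auto simp: mem)
      then show ?thesis by (simp only: card.empty)
    qed
    ultimately show "(\<lambda>c. card {i. i < length \<mu> \<and> c \<in> Ss ! i}) \<in> exps N B"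
      by (auto simp: exps_def)
    have "prod_list (map (\<lambda>S. \<Prod>c\<in>S. x c) Ss) = (\<Prod>i<length \<mu>. \<Prod>c\<in>Ss ! i. x c)"
      using Ss by (simp add: prod.list_conv_set_nth mem atLeast0LessThan)
    also have "\<dots> = (\<Prod>i<length \<mu>. \<Prod>c<N. if c \<in> Ss ! i then x c else 1)"
    proof (rule prod.cong[OF refl])
      fix i assume "i \<in> {..<length \<mu>}"
      then have "{c \<in> {..<N}. c \<in> Ss ! i} = Ss ! i" using Ss by (auto simp: mem)
      then show "(\<Prod>c\<in>Ss ! i. x c) = (\<Prod>c<N. if c \<in> Ss ! i then x c else 1)"
        by (subst prod.inter_filter[symmetric]) simp_all
    qed
    finally show "prod_list (map (\<lambda>S. \<Prod>c\<in>S. x c) Ss) =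
        (\<Prod>c<N. x c ^ card {i. i < length \<mu> \<and> c \<in> Ss ! i})"
      by (simp add: prod_power_card)
  next
    fix \<alpha> assume \<alpha>: "\<alpha> \<in> exps N B"
    have sub: "c < N" if "i < length \<mu>" "c \<in> Ss ! i" "\<forall>c. card {i. i < length \<mu> \<and> c \<in> Ss ! i} = \<alpha> c" for Ss i c
    proof (rule ccontr)
      assume "\<not> c < N"
      then have "\<alpha> c = 0" using \<alpha> by (auto simp: exps_def)
      then have "card {i. i < length \<mu> \<and> c \<in> Ss ! i} = 0" using that by simp
      then show False using that(1,2) by auto
    qed
    show "elem_sym_coeff \<mu> \<alpha> = card {Ss \<in> listset As.
        (\<lambda>c. card {i. i < length \<mu> \<and> c \<in> Ss ! i}) = \<alpha>}"
      unfolding elem_sym_coeff_def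
      by (intro arg_cong[where f = card])
        (auto simp: mem fun_eq_iff dest: sub intro: finite_subset[OF _ finite_lessThan])
  qed
  also have "\<dots> = prod_list (map (esym N x) \<mu>)"
    by (simp add: sum_listset_prod_list As_def esym_def[abs_def] comp_def)
  finally show ?thesis .
qed

lemma partitions_of_length: "\<mu> \<in> partitions_of n \<Longrightarrow> length \<mu> \<le> n"
proof -
  have "0 \<notin> set \<mu> \<Longrightarrow> length \<mu> \<le> sum_list \<mu>" by (induction \<mu>) auto
  then show "\<mu> \<in> partitions_of n \<Longrightarrow> length \<mu> \<le> n" by (auto simp: partitions_of_def)
qed

text \<open>Multiply the coefficient identities by monomials and sum over the box with bound
  \<open>card V\<close>. This bound suits both sides, since a partition of \<open>card V\<close> has
  at most \<open>card V\<close> parts.\<close>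

lemma e_positive_color_sum:
  fixes V :: "'v set"
  assumes "e_positive V E" "finite V"
  obtains d :: "nat list \<Rightarrow> real" where "\<And>\<mu>. d \<mu> \<ge> 0"
    "\<And>N (x :: nat \<Rightarrow> complex). color_sum V E N x =
       (\<Sum>\<mu>\<in>partitions_of (card V). of_real (d \<mu>) * prod_list (map (esym N x) \<mu>))"
proof -
  from assms(1) obtain d :: "nat list \<Rightarrow> real" where d: "\<And>\<mu>. d \<mu> \<ge> 0"
    and eq: "\<And>\<alpha>. real (chrom_sym_coeff V E \<alpha>) =
      (\<Sum>\<mu>\<in>partitions_of (card V). d \<mu> * real (elem_sym_coeff \<mu> \<alpha>))"
    unfolding e_positive_def by blast
  have ceq: "of_nat (chrom_sym_coeff V E \<alpha>) = 
      (\<Sum>\<mu>\<in>partitions_of (card V). of_real (d \<mu>) * (of_nat (elem_sym_coeff \<mu> \<alpha>) :: complex))" for \<alpha>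
    using arg_cong[OF eq[of \<alpha>], of complex_of_real] by simp
  show ?thesis
  proof (rule that[OF d])
    fix N and x :: "nat \<Rightarrow> complex"
    have "color_sum V E N x =
      (\<Sum>\<alpha>\<in>exps N (card V). of_nat (chrom_sym_coeff V E \<alpha>) * (\<Prod>c<N. x c ^ \<alpha> c))"
      using assms by (simp add: sum_chrom_sym_coeff)
    also have "\<dots> = (\<Sum>\<mu>\<in>partitions_of (card V). of_real (d \<mu>) *
        (\<Sum>\<alpha>\<in>exps N (card V). of_nat (elem_sym_coeff \<mu> \<alpha>) * (\<Prod>c<N. x c ^ \<alpha> c)))"
      unfolding ceq sum_distrib_right sum_distrib_left mult.assoc by (rule sum.swap)
    also have "\<dots> = (\<Sum>\<mu>\<in>partitions_of (card V). of_real (d \<mu>) * prod_list (map (esym N x) \<mu>))"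
      by (intro sum.cong refl) (simp add: sum_elem_sym_coeff partitions_of_length)
    finally show "color_sum V E N x = \<dots>" .
  qed
qed

section \<open>Chromatic symmetric functions of paths and spiders\<close>

text \<open>The weighted proper colourings of a leg of \<open>l\<close> vertices hanging from a
  vertex of colour \<open>i\<close>, the weight of that vertex excluded.\<close>

primrec leg_sum :: "nat \<Rightarrow> (nat \<Rightarrow> 'a::comm_ring_1) \<Rightarrow> nat \<Rightarrow> nat \<Rightarrow> 'a" where
  "leg_sum N x 0 i = 1"
| "leg_sum N x (Suc l) i = (\<Sum>j\<in>{..<N} - {i}. x j * leg_sum N x l j)"

primrec path_sum :: "nat \<Rightarrow> (nat \<Rightarrow> 'a::comm_ring_1) \<Rightarrow> nat \<Rightarrow> 'a" where
  "path_sum N x 0 = 1"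
| "path_sum N x (Suc n) = (\<Sum>i<N. x i * leg_sum N x n i)"

lemma leg_sum_Suc:
  "i < N \<Longrightarrow> leg_sum N x (Suc n) i = path_sum N x (Suc n) - x i * leg_sum N x n i"
  by (simp add: sum_diff1)

text \<open>Two legs at a common vertex form a path. The induction slides the distinguished vertex
  one step along the second leg, shortening it and lengthening the first.\<close>

lemma sum_leg_sum_mult:
  "(\<Sum>i<N. x i * leg_sum N x a i * leg_sum N x b i) = path_sum N x (Suc (a + b))"
proof (induction b arbitrary: a)
  case (Suc b)
  have "(\<Sum>i<N. x i * leg_sum N x a i * leg_sum N x (Suc b) i) =
      (\<Sum>i<N. \<Sum>j<N. if j \<noteq> i then x i * leg_sum N x a i * (x j * leg_sum N x b j) else 0)"
    by (auto simp: sum_distrib_left sum.inter_filter[symmetric] intro!: sum.cong)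
  also have "\<dots> = (\<Sum>j<N. \<Sum>i<N. if i \<noteq> j then x j * leg_sum N x b j * (x i * leg_sum N x a i) else 0)"
    by (subst sum.swap) (auto intro!: sum.cong simp: mult_ac)
  also have "\<dots> = (\<Sum>j<N. x j * leg_sum N x (Suc a) j * leg_sum N x b j)"
    by (auto simp: sum_distrib_left sum_distrib_right sum.inter_filter[symmetric] mult_ac intro!: sum.cong)
  finally show ?case using Suc[of "Suc a"] by simp
qed simp

text \<open>At a centre of colour \<open>i\<close> the one-vertex leg contributes
  \<open>e_1 - x i\<close>, and the factor \<open>x i\<close> is absorbed through \<open>x i *
  leg_sum N x b i = path_sum N x (b + 1) - leg_sum N x (b + 1) i\<close>. Only two-legged sums
  remain, and these are paths.\<close>

lemma sum_leg_sum_spider: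
  "(\<Sum>i<N. x i * leg_sum N x a i * leg_sum N x b i * leg_sum N x 1 i) =
     path_sum N x (a + b + 2) + esym N x 1 * path_sum N x (a + b + 1)
       - path_sum N x (a + 1) * path_sum N x (b + 1)"
proof -
  have "(\<Sum>i<N. x i * leg_sum N x a i * leg_sum N x b i * leg_sum N x 1 i) =
      (\<Sum>i<N. esym N x 1 * (x i * leg_sum N x a i * leg_sum N x b i)
        - (path_sum N x (Suc b) * (x i * leg_sum N x a i)
            - x i * leg_sum N x a i * leg_sum N x (Suc b) i))"
  proof (rule sum.cong[OF refl])
    fix i assume "i \<in> {..<N}"
    then have "leg_sum N x 1 i = esym N x 1 - x i"
      and "leg_sum N x (Suc b) i = path_sum N x (Suc b) - x i * leg_sum N x b i"
      using leg_sum_Suc[of i N x 0] leg_sum_Suc[of i N x b] by (simp_all add: esym_1)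
    then show "x i * leg_sum N x a i * leg_sum N x b i * leg_sum N x 1 i =
       esym N x 1 * (x i * leg_sum N x a i * leg_sum N x b i)
        - (path_sum N x (Suc b) * (x i * leg_sum N x a i)
            - x i * leg_sum N x a i * leg_sum N x (Suc b) i)"
      by (simp only:) (simp only: algebra_simps)
  qed
  also have "\<dots> = esym N x 1 * path_sum N x (Suc (a + b)) -
      (path_sum N x (Suc b) * path_sum N x (Suc a) - path_sum N x (Suc (a + Suc b)))"
    unfolding sum_subtractf sum_distrib_left[symmetric] sum_leg_sum_mult by simp
  finally show ?thesis by (simp add: algebra_simps del: path_sum.simps)
qed

section \<open>The elementary expansion of paths\<close>

text \<open>The recurrence is \<open>P (E - t E') = E\<close> for the generating functions \<open>P\<close> of the path sums and
  \<open>E\<close> of the \<open>z k\<close> (with \<open>z 0\<close> read as 1).\<close>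

fun path_e :: "(nat \<Rightarrow> 'a::comm_ring_1) \<Rightarrow> nat \<Rightarrow> 'a" where
  "path_e z n = (if n = 0 then 1
     else z n + (\<Sum>k\<in>{2..n}. of_nat (k - 1) * z k * path_e z (n - k)))"

declare path_e.simps [simp del]

lemma fps_deriv_prod:
  fixes f :: "'b \<Rightarrow> 'a::comm_ring_1 fps"
  assumes "finite A"
  shows "fps_deriv (prod f A) = (\<Sum>i\<in>A. fps_deriv (f i) * prod f (A - {i}))"
  using assms
proof (induction A)
  case (insert a A)
  have "prod f (insert a A - {i}) = f a * prod f (A - {i})" if "i \<in> A" for i
  proof -
    have "insert a A - {i} = insert a (A - {i})" using that insert by auto
    then show ?thesis using insert by simp
  qed
  then have "(\<Sum>i\<in>A. fps_deriv (f i) * prod f (insert a A - {i})) =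
      f a * (\<Sum>i\<in>A. fps_deriv (f i) * prod f (A - {i}))"
    by (simp add: sum_distrib_left mult_ac)
  then show ?case using insert by simp
qed simp

text \<open>With \<open>U i\<close> the generating function of legs at colour \<open>i\<close>, one
  has \<open>P = (1 + x_i t) U_i\<close> and \<open>P = 1 + t * sum x_i U_i\<close>. Multiplying the
  latter by \<open>E = prod (1 + x_j t)\<close> turns the sum into \<open>E' P\<close>, so
  \<open>E P = E + t E' P\<close>; comparing coefficients gives the recurrence.\<close>

lemma path_sum_eq_path_e:
  fixes x :: "nat \<Rightarrow> 'a::comm_ring_1"
  shows "path_sum N x n = path_e (esym N x) n"
proof (induction n rule: less_induct)
  case (less n)
  define E where "E = Abs_fps (esym N x)"
  define P where "P = Abs_fps (path_sum N x)"
  define U where "U i = Abs_fps (\<lambda>n. leg_sum N x n i)" for i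
  define Q where "Q i = (\<Prod>j\<in>{..<N} - {i}. 1 + fps_const (x j) * fps_X)" for i
  have PU: "P = (1 + fps_const (x i) * fps_X) * U i" if "i < N" for i
  proof (rule fps_ext)
    show "fps_nth P k = fps_nth ((1 + fps_const (x i) * fps_X) * U i) k" for k
    proof (cases k)
      case (Suc m)
      then show ?thesis
        using leg_sum_Suc[OF that, of x m]
        by (simp add: P_def U_def ring_distribs mult.assoc del: path_sum.simps leg_sum.simps)
    qed (simp add: P_def U_def ring_distribs mult.assoc)
  qed
  have P1: "P = 1 + fps_X * (\<Sum>i<N. fps_const (x i) * U i)"
  proof (rule fps_ext)
    show "fps_nth P k = fps_nth (1 + fps_X * (\<Sum>i<N. fps_const (x i) * U i)) k" for k
      by (cases k) (simp_all add: P_def U_def fps_sum_nth)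
  qed
  have E_prod: "E = (\<Prod>j<N. 1 + fps_const (x j) * fps_X)"
    by (simp add: E_def prod_one_plus_esym)
  have EQ: "E = (1 + fps_const (x i) * fps_X) * Q i" if "i < N" for i
    unfolding E_prod Q_def by (rule prod.remove) (use that in auto)
  have E': "fps_deriv E = (\<Sum>i<N. fps_const (x i) * Q i)"
    unfolding E_prod by (simp add: fps_deriv_prod Q_def)
  \<comment> \<open>Since \<open>E = (1 + x_i t) Q_i\<close>, the factor \<open>1 + x_i t\<close>
    moves from \<open>E\<close> to \<open>U i\<close>, and no division of power series is
    required.\<close>
  have "E * U i = Q i * P" if "i < N" for i
    by (subst EQ[OF that], subst PU[OF that]) (simp only: mult_ac)
  then have EU: "(\<Sum>i<N. fps_const (x i) * (E * U i)) = fps_deriv E * P"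
    by (simp add: E' sum_distrib_right mult.assoc)
  have "E * P = E + fps_X * (\<Sum>i<N. fps_const (x i) * (E * U i))"
    by (subst P1) (simp add: ring_distribs sum_distrib_left mult_ac)
  also have "fps_X * (\<Sum>i<N. fps_const (x i) * (E * U i)) = Abs_fps (\<lambda>k. of_nat k * esym N x k) * P"
  proof -
    have "fps_X * fps_deriv E = Abs_fps (\<lambda>k. of_nat k * esym N x k)"
      by (rule fps_ext) (auto simp: E_def)
    then show ?thesis unfolding EU by (metis mult.assoc)
  qed
  finally have EP: "E * P = E + Abs_fps (\<lambda>k. of_nat k * esym N x k) * P" .
  show ?case
  proof (cases "n = 0")
    case False
    have "(\<Sum>k=0..n. esym N x k * path_sum N x (n - k)) =
        esym N x n + (\<Sum>k=0..n. of_nat k * esym N x k * path_sum N x (n - k))"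
      using arg_cong[OF EP, of "\<lambda>f. fps_nth f n"] by (simp add: fps_mult_nth E_def P_def)
    then have "path_sum N x n = esym N x n + (\<Sum>k=Suc 0..n. of_nat k * esym N x k * path_sum N x (n - k))
        - (\<Sum>k=Suc 0..n. esym N x k * path_sum N x (n - k))"
      by (simp add: sum.atLeast_Suc_atMost algebra_simps)
    also have "\<dots> = esym N x n + (\<Sum>k=Suc 0..n. of_nat (k - 1) * esym N x k * path_sum N x (n - k))"
      by (simp add: of_nat_diff algebra_simps sum_subtractf)
    \<comment> \<open>The term \<open>k = 1\<close> has factor 0.\<close>
    also have "(\<Sum>k=Suc 0..n. of_nat (k - 1) * esym N x k * path_sum N x (n - k)) =
        (\<Sum>k=2..n. of_nat (k - 1) * esym N x k * path_sum N x (n - k))"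
      using False by (simp add: sum.atLeast_Suc_atMost numeral_2_eq_2)
    also have "\<dots> = (\<Sum>k=2..n. of_nat (k - 1) * esym N x k * path_e (esym N x) (n - k))"
      by (rule sum.cong) (use less in auto)
    finally show ?thesis by (subst path_e.simps) (simp add: False)
  qed (simp add: path_e.simps)
qed

lemma path_e_cong:
  assumes "\<And>k. 1 \<le> k \<Longrightarrow> k \<le> n \<Longrightarrow> z k = w k"
  shows "path_e z n = path_e w n"
  using assms
proof (induction n rule: less_induct)
  case (less n)
  have "(\<Sum>k=2..n. of_nat (k - 1) * z k * path_e z (n - k)) =
      (\<Sum>k=2..n. of_nat (k - 1) * w k * path_e w (n - k))"
    using less by (intro sum.cong refl arg_cong2[where f = "(*)"]) auto
  then show ?case
    using less.prems[of n] by (subst (1 2) path_e.simps) simp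
qed

text \<open>The recurrence uses only ring operations and integer constants. This allows evaluation
  of real polynomials at a point, followed by the embedding into the complex numbers.\<close>

lemma path_e_hom:
  fixes h :: "'a::comm_ring_1 \<Rightarrow> 'b::comm_ring_1"
  assumes "h 1 = 1" "\<And>u v. h (u + v) = h u + h v" "\<And>u v. h (u * v) = h u * h v"
  shows "h (path_e z n) = path_e (\<lambda>k. h (z k)) n"
proof (induction n rule: less_induct)
  case (less n)
  have h0: "h 0 = 0" using assms(2)[of 0 0] by simp
  have hsum: "h (sum g A) = (\<Sum>a\<in>A. h (g a))" for g and A :: "nat set"
    by (induction A rule: infinite_finite_induct) (simp_all add: assms h0)
  have hnat: "h (of_nat m) = of_nat m" for m
    by (induction m) (simp_all add: assms h0)
  show ?case
    by (subst (1 2) path_e.simps) (auto simp: assms hsum hnat less simp del: of_nat_diff intro!: sum.cong)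
qed

section \<open>Summing over the colourings of a rooted tree, leg by leg\<close>

lemma sum_PiE_insert:
  assumes "v \<notin> V"
  shows "(\<Sum>\<kappa>\<in>insert v V \<rightarrow>\<^sub>E S. h \<kappa>) = (\<Sum>\<kappa>\<in>V \<rightarrow>\<^sub>E S. \<Sum>c\<in>S. h (\<kappa>(v := c)))"
proof -
  have "(\<Sum>\<kappa>\<in>insert v V \<rightarrow>\<^sub>E S. h \<kappa>) = (\<Sum>(c, \<kappa>)\<in>S \<times> (V \<rightarrow>\<^sub>E S). h (\<kappa>(v := c)))"
    unfolding PiE_insert_eq
    by (subst sum.reindex[OF inj_combinator[OF assms]]) (simp add: case_prod_unfold)
  then show ?thesis
    by (subst sum.swap) (simp add: sum.cartesian_product)
qed

text \<open>Here \<open>p v\<close> is the parent of the vertex \<open>v\<close> in a tree with root 0.\<close>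

definition tree_sum ::
    "(nat \<Rightarrow> nat) \<Rightarrow> nat \<Rightarrow> (nat \<Rightarrow> 'a::comm_ring_1) \<Rightarrow> nat \<Rightarrow> ((nat \<Rightarrow> nat) \<Rightarrow> 'a) \<Rightarrow> 'a" where
  "tree_sum p N x n F = (\<Sum>\<kappa>\<in>{..n} \<rightarrow>\<^sub>E {..<N}.
     if \<forall>v\<in>{1..n}. \<kappa> v \<noteq> \<kappa> (p v) then (\<Prod>v\<le>n. x (\<kappa> v)) * F \<kappa> else 0)"

lemma tree_sum_0: "tree_sum p N x 0 F = (\<Sum>c<N. x c * F ((\<lambda>_. undefined)(0 := c)))"
  using sum_PiE_insert[where v = 0 and V = "{}" and S = "{..<N}" and h = "\<lambda>\<kappa>. x (\<kappa> 0) * F \<kappa>"]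
  by (simp add: tree_sum_def fun_upd_def)

text \<open>Parents have smaller numbers, so the last vertex is a leaf; its colour is constrained
  only by its parent and, as \<open>F\<close> ignores it, can be summed out first.\<close>

lemma tree_sum_Suc:
  assumes p: "\<And>v. 1 \<le> v \<Longrightarrow> p v < v" and F: "\<And>\<kappa> c. F (\<kappa>(Suc n := c)) = F \<kappa>"
  shows "tree_sum p N x (Suc n) (\<lambda>\<kappa>. F \<kappa> * G (\<kappa> (Suc n))) =
    tree_sum p N x n (\<lambda>\<kappa>. F \<kappa> * (\<Sum>c\<in>{..<N} - {\<kappa> (p (Suc n))}. x c * G c))"
proof -
  have "tree_sum p N x (Suc n) (\<lambda>\<kappa>. F \<kappa> * G (\<kappa> (Suc n))) =
     (\<Sum>\<kappa>\<in>{..n} \<rightarrow>\<^sub>E {..<N}. \<Sum>c<N.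
       if \<forall>v\<in>{1..Suc n}. (\<kappa>(Suc n := c)) v \<noteq> (\<kappa>(Suc n := c)) (p v)
       then (\<Prod>v\<le>Suc n. x ((\<kappa>(Suc n := c)) v)) * (F \<kappa> * G c) else 0)"
    unfolding tree_sum_def atMost_Suc
    by (subst sum_PiE_insert) (simp_all add: F cong: if_cong)
  also have "\<dots> = tree_sum p N x n (\<lambda>\<kappa>. F \<kappa> * (\<Sum>c\<in>{..<N} - {\<kappa> (p (Suc n))}. x c * G c))"
    unfolding tree_sum_def
  proof (rule sum.cong[OF refl])
    fix \<kappa> :: "nat \<Rightarrow> nat"
    have ne: "p v \<noteq> Suc n" "v \<noteq> Suc n" if "v \<in> {1..n}" for v using p[of v] that by auto
    have ne': "p (Suc n) \<noteq> Suc n" using p[of "Suc n"] by auto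
    have cond: "(\<forall>v\<in>{1..Suc n}. (\<kappa>(Suc n := c)) v \<noteq> (\<kappa>(Suc n := c)) (p v)) \<longleftrightarrow>
        (\<forall>v\<in>{1..n}. \<kappa> v \<noteq> \<kappa> (p v)) \<and> c \<noteq> \<kappa> (p (Suc n))" for c
      using ne ne' by (auto simp: atLeastAtMostSuc_conv)
    have prod: "(\<Prod>v\<le>Suc n. x ((\<kappa>(Suc n := c)) v)) = (\<Prod>v\<le>n. x (\<kappa> v)) * x c" for c
      by simp
    have "(\<Sum>c\<in>{..<N} - {k}. x c * G c) = (\<Sum>c<N. if c \<noteq> k then x c * G c else 0)" for k
      by (subst sum.inter_filter[symmetric]) (auto intro: sum.cong)
    then show "(\<Sum>c<N. if \<forall>v\<in>{1..Suc n}. (\<kappa>(Suc n := c)) v \<noteq> (\<kappa>(Suc n := c)) (p v)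
       then (\<Prod>v\<le>Suc n. x ((\<kappa>(Suc n := c)) v)) * (F \<kappa> * G c) else 0) =
     (if \<forall>v\<in>{1..n}. \<kappa> v \<noteq> \<kappa> (p v) then (\<Prod>v\<le>n. x (\<kappa> v)) *
        (F \<kappa> * (\<Sum>c\<in>{..<N} - {\<kappa> (p (Suc n))}. x c * G c)) else 0)"
      unfolding cond prod
      by (cases "\<forall>v\<in>{1..n}. \<kappa> v \<noteq> \<kappa> (p v)") (simp_all add: sum_distrib_left mult_ac if_distrib cong: if_cong)
  qed
  finally show ?thesis .
qed

text \<open>Strip the leg from its far end. The index \<open>t\<close> counts vertices already
  absorbed into the weight, which finally sits at the attachment vertex
  \<open>p (m + 1)\<close>.\<close>

lemma tree_sum_leg:
  assumes p: "\<And>v. 1 \<le> v \<Longrightarrow> p v < v" and F: "\<And>\<kappa> v c. m < v \<Longrightarrow> F (\<kappa>(v := c)) = F \<kappa>"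
    and "\<And>v. m + 1 < v \<Longrightarrow> v \<le> m + l \<Longrightarrow> p v = v - 1" and "1 \<le> l"
  shows "tree_sum p N x (m + l) (\<lambda>\<kappa>. F \<kappa> * leg_sum N x t (\<kappa> (m + l))) =
    tree_sum p N x m (\<lambda>\<kappa>. F \<kappa> * leg_sum N x (t + l) (\<kappa> (p (m + 1))))"
  using assms(4,3)
proof (induction l arbitrary: t rule: nat_induct_at_least)
  case base
  then show ?case
    using tree_sum_Suc[where F = F and G = "leg_sum N x t" and n = m, OF p F] by simp
next
  case (Suc l)
  have "tree_sum p N x (m + Suc l) (\<lambda>\<kappa>. F \<kappa> * leg_sum N x t (\<kappa> (m + Suc l))) =
      tree_sum p N x (m + l) (\<lambda>\<kappa>. F \<kappa> * leg_sum N x (Suc t) (\<kappa> (p (Suc (m + l)))))"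
    using tree_sum_Suc[where F = F and G = "leg_sum N x t" and n = "m + l", OF p F] by simp
  also have "p (Suc (m + l)) = m + l" using Suc by simp
  also have "tree_sum p N x (m + l) (\<lambda>\<kappa>. F \<kappa> * leg_sum N x (Suc t) (\<kappa> (m + l))) =
      tree_sum p N x m (\<lambda>\<kappa>. F \<kappa> * leg_sum N x (Suc t + l) (\<kappa> (p (m + 1))))"
    using Suc by (simp del: leg_sum.simps)
  finally show ?case by simp
qed

lemma color_sum_spider:
  fixes x :: "nat \<Rightarrow> 'a::comm_ring_1"
  assumes "1 \<le> a" "1 \<le> b"
  shows "color_sum (spider_vertices a b 1) (spider_adj a b 1) N x =
    (\<Sum>i<N. x i * leg_sum N x a i * leg_sum N x b i * leg_sum N x 1 i)"
proof -
  define p where "p v = (if v = 1 \<or> v = a + 1 \<or> v = a + b + 1 then 0 else v - 1)" for v :: nat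
  have p: "p v < v" if "1 \<le> v" for v using that by (auto simp: p_def)
  have adj: "spider_adj a b 1 u v \<longleftrightarrow> 1 \<le> v \<and> v \<le> a + b + 1 \<and> u = p v \<or> 1 \<le> u \<and> u \<le> a + b + 1 \<and> v = p u" for u v
    using assms unfolding spider_adj_def spider_edge_def p_def
    by (cases u; cases v) auto
  have cond: "(\<forall>u\<in>{..a + b + 1}. \<forall>v\<in>{..a + b + 1}. spider_adj a b 1 u v \<longrightarrow> \<kappa> u \<noteq> \<kappa> v) \<longleftrightarrow>
      (\<forall>v\<in>{1..a + b + 1}. \<kappa> v \<noteq> \<kappa> (p v))" for \<kappa> :: "nat \<Rightarrow> nat"
  proof
    assume *: "\<forall>u\<in>{..a + b + 1}. \<forall>v\<in>{..a + b + 1}. spider_adj a b 1 u v \<longrightarrow> \<kappa> u \<noteq> \<kappa> v"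
    show "\<forall>v\<in>{1..a + b + 1}. \<kappa> v \<noteq> \<kappa> (p v)"
    proof
      fix v assume v: "v \<in> {1..a + b + 1}"
      then have "p v \<le> a + b + 1" using p[of v] by simp
      then show "\<kappa> v \<noteq> \<kappa> (p v)" using * v adj[of v "p v"] by simp
    qed
  next
    assume *: "\<forall>v\<in>{1..a + b + 1}. \<kappa> v \<noteq> \<kappa> (p v)"
    show "\<forall>u\<in>{..a + b + 1}. \<forall>v\<in>{..a + b + 1}. spider_adj a b 1 u v \<longrightarrow> \<kappa> u \<noteq> \<kappa> v"
      unfolding adj using * by (metis atLeastAtMost_iff)
  qed
  have "color_sum (spider_vertices a b 1) (spider_adj a b 1) N x =
      tree_sum p N x (a + b + 1) (\<lambda>\<kappa>. 1 * leg_sum N x 0 (\<kappa> (a + b + 1)))"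
    unfolding color_sum_def tree_sum_def spider_vertices_def atLeast0AtMost cond
    by (subst sum.inter_filter[symmetric]) (auto intro!: finite_PiE)
  \<comment> \<open>The legs go in decreasing order of vertex numbers: third, second, first. The
    trivial factor \<open>leg_sum N x 0\<close> starts each stripping.\<close>
  also have "\<dots> = tree_sum p N x (a + b) (\<lambda>\<kappa>. 1 * leg_sum N x (0 + 1) (\<kappa> (p (a + b + 1))))"
    by (rule tree_sum_leg[OF p]) simp_all
  also have "\<dots> = tree_sum p N x (a + b) (\<lambda>\<kappa>. leg_sum N x 1 (\<kappa> 0) * leg_sum N x 0 (\<kappa> (a + b)))"
    by (simp add: p_def)
  also have "\<dots> = tree_sum p N x a (\<lambda>\<kappa>. leg_sum N x 1 (\<kappa> 0) * leg_sum N x (0 + b) (\<kappa> (p (a + 1))))"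
    using assms by (intro tree_sum_leg[OF p]) (simp_all add: p_def)
  also have "\<dots> = tree_sum p N x (0 + a) (\<lambda>\<kappa>. (leg_sum N x 1 (\<kappa> 0) * leg_sum N x b (\<kappa> 0)) * leg_sum N x 0 (\<kappa> (0 + a)))"
    by (simp add: p_def)
  also have "\<dots> = tree_sum p N x 0 (\<lambda>\<kappa>. (leg_sum N x 1 (\<kappa> 0) * leg_sum N x b (\<kappa> 0)) * leg_sum N x (0 + a) (\<kappa> (p (0 + 1))))"
    using assms by (intro tree_sum_leg[OF p]) (simp_all add: p_def)
  also have "\<dots> = (\<Sum>i<N. x i * leg_sum N x a i * leg_sum N x b i * leg_sum N x 1 i)"
    unfolding tree_sum_0 by (intro sum.cong refl) (simp add: p_def mult_ac del: leg_sum.simps)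
  finally show ?thesis .
qed

section \<open>From e-positivity to nonnegative coefficients of specializations\<close>

text \<open>For each real \<open>t\<close> there is a complex point where every \<open>e_k\<close>
  with \<open>1 \<le> k \<le> a + b + 2\<close> takes the value of \<open>z k\<close> at
  \<open>t\<close>. There the path formula and the e-expansion agree, hence they agree as
  polynomials in \<open>t\<close>, and the latter is a nonnegative combination of products of the
  \<open>z k\<close>.\<close>

lemma spider_coeff_nonneg:
  fixes z :: "nat \<Rightarrow> real poly"
  assumes "e_positive (spider_vertices a b 1) (spider_adj a b 1)" "1 \<le> a" "1 \<le> b"
    and z: "\<And>k i. coeff (z k) i \<ge> 0"
  shows "coeff (path_e z (a + b + 2) + z 1 * path_e z (a + b + 1)
      - path_e z (a + 1) * path_e z (b + 1)) i \<ge> 0"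
proof -
  define S where "S = path_e z (a + b + 2) + z 1 * path_e z (a + b + 1) - path_e z (a + 1) * path_e z (b + 1)"
  let ?V = "spider_vertices a b 1" and ?n = "a + b + 2"
  have V: "finite ?V" "card ?V = ?n" by (simp_all add: spider_vertices_def)
  obtain d where d: "\<And>\<mu>. d \<mu> \<ge> 0" and eq: "\<And>N (x :: nat \<Rightarrow> complex).
      color_sum ?V (spider_adj a b 1) N x =
       (\<Sum>\<mu>\<in>partitions_of ?n. of_real (d \<mu>) * prod_list (map (esym N x) \<mu>))"
    using e_positive_color_sum[OF assms(1) V(1)] V(2) by metis
  define R where "R = (\<Sum>\<mu>\<in>partitions_of ?n. smult (d \<mu>) (prod_list (map z \<mu>)))"
  have "poly S t = poly R t" for t
  proof -
    define w where "w k = complex_of_real (poly (z k) t)" for k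
    obtain x where x: "\<And>k. 1 \<le> k \<Longrightarrow> k \<le> ?n \<Longrightarrow> esym ?n x k = w k"
      using esym_surj by blast
    have hom: "complex_of_real (poly (path_e z k) t) = path_e w k" for k
      unfolding w_def by (rule path_e_hom) simp_all
    have path: "path_sum ?n x k = path_e w k" if "k \<le> ?n" for k
      unfolding path_sum_eq_path_e using that by (intro path_e_cong x) simp_all
    have "complex_of_real (poly S t) = color_sum ?V (spider_adj a b 1) ?n x"
      unfolding color_sum_spider[OF assms(2,3)] sum_leg_sum_spider
      by (simp add: S_def hom path x w_def[of 1, symmetric]
          del: leg_sum.simps path_sum.simps One_nat_def add_2_eq_Suc')
    also have "\<dots> = (\<Sum>\<mu>\<in>partitions_of ?n. of_real (d \<mu>) * prod_list (map w \<mu>))"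
      unfolding eq
    proof (intro sum.cong refl arg_cong2[where f = "(*)"] arg_cong[where f = prod_list] map_cong)
      fix \<mu> k assume "\<mu> \<in> partitions_of ?n" "k \<in> set \<mu>"
      then have "1 \<le> k" "k \<le> ?n" using member_le_sum_list[of k \<mu>]
        by (auto simp: partitions_of_def Suc_le_eq intro: Nat.gr0I)
      then show "esym ?n x k = w k" by (rule x)
    qed
    also have "\<dots> = complex_of_real (poly R t)"
    proof -
      have "prod_list (map w \<mu>) = complex_of_real (poly (prod_list (map z \<mu>)) t)" for \<mu>
        by (induction \<mu>) (simp_all add: w_def)
      then show ?thesis by (simp add: R_def poly_sum)
    qed
    finally show ?thesis by (simp only: of_real_eq_iff)
  qed
  then have "S = R" by (simp add: poly_eq_poly_eq_iff[symmetric] fun_eq_iff)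
  moreover have "coeff (prod_list (map z \<mu>)) i \<ge> 0" for \<mu> i
    by (induction \<mu> arbitrary: i) (auto simp: coeff_mult z coeff_1 intro!: sum_nonneg mult_nonneg_nonneg)
  ultimately show ?thesis
    using d unfolding S_def[symmetric]
    by (simp add: R_def coeff_sum sum_nonneg del: add_2_eq_Suc')
qed

section \<open>Coefficients involving two part sizes\<close>

text \<open>The specialization \<open>e\<^sub>M = 1\<close>, \<open>e\<^sub>m = X\<close>, all other \<open>e\<^sub>k = 0\<close>: the coefficient of \<open>X ^ j\<close> in the
  degree \<open>n\<close> part is the coefficient of \<open>e\<^sub>M\<^bsup>i\<^esup> e\<^sub>m\<^bsup>j\<^esup>\<close> with \<open>i M + j m = n\<close>.\<close>

definition two_parts :: "nat \<Rightarrow> nat \<Rightarrow> nat \<Rightarrow> real poly" where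
  "two_parts M m k = (if k = M then 1 else if k = m then monom 1 1 else 0)"

definition path_coeff :: "nat \<Rightarrow> nat \<Rightarrow> nat \<Rightarrow> nat \<Rightarrow> real" where
  "path_coeff M m j n = coeff (path_e (two_parts M m) n) j"

lemma path_coeff_0 [simp]: "path_coeff M m j 0 = (if j = 0 then 1 else 0)"
  by (simp add: path_coeff_def path_e.simps coeff_1)

context
  fixes M m :: nat
  assumes M: "2 \<le> M" and m: "2 \<le> m" and Mm: "M \<noteq> m"
begin

lemma path_e_two_parts:
  assumes "n > 0"
  shows "path_e (two_parts M m) n = two_parts M m n
    + (if M \<le> n then of_nat (M - 1) * path_e (two_parts M m) (n - M) else 0)
    + (if m \<le> n then of_nat (m - 1) * monom 1 1 * path_e (two_parts M m) (n - m) else 0)"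
proof -
  have "(\<Sum>k=2..n. of_nat (k - 1) * two_parts M m k * path_e (two_parts M m) (n - k)) =
    (\<Sum>k=2..n. (if k = M then of_nat (M - 1) * path_e (two_parts M m) (n - M) else 0)
      + (if k = m then of_nat (m - 1) * monom 1 1 * path_e (two_parts M m) (n - m) else 0))"
    using Mm by (intro sum.cong) (auto simp: two_parts_def simp del: of_nat_diff)
  also have "\<dots> = (if M \<le> n then of_nat (M - 1) * path_e (two_parts M m) (n - M) else 0)
    + (if m \<le> n then of_nat (m - 1) * monom 1 1 * path_e (two_parts M m) (n - m) else 0)"
    using M m by (simp add: sum.distrib del: of_nat_diff)
  finally show ?thesis using assms by (subst path_e.simps) (simp add: add.assoc)
qed

lemma path_coeff_rec:
  assumes "n > 0"
  shows "path_coeff M m 0 n = (if n = M then 1 else 0)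
      + (if M \<le> n then (real M - 1) * path_coeff M m 0 (n - M) else 0)"
    and "path_coeff M m (Suc j) n = (if n = m \<and> j = 0 then 1 else 0)
      + (if M \<le> n then (real M - 1) * path_coeff M m (Suc j) (n - M) else 0)
      + (if m \<le> n then (real m - 1) * path_coeff M m j (n - m) else 0)"
proof -
  have *: "of_nat (k - 1) * q = smult (real k - 1) q" if "2 \<le> k" for k and q :: "real poly"
    using that by (simp add: of_nat_poly of_nat_diff)
  have X: "of_nat (m - 1) * monom 1 1 * q = smult (real m - 1) (pCons 0 q)" for q :: "real poly"
    unfolding mult.assoc *[OF m] by (simp add: monom_altdef)
  have "path_e (two_parts M m) n = two_parts M m n
    + (if M \<le> n then smult (real M - 1) (path_e (two_parts M m) (n - M)) else 0)
    + (if m \<le> n then smult (real m - 1) (pCons 0 (path_e (two_parts M m) (n - m))) else 0)"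
    unfolding path_e_two_parts[OF assms] X *[OF M] ..
  then show "path_coeff M m 0 n = (if n = M then 1 else 0)
      + (if M \<le> n then (real M - 1) * path_coeff M m 0 (n - M) else 0)"
    and "path_coeff M m (Suc j) n = (if n = m \<and> j = 0 then 1 else 0)
      + (if M \<le> n then (real M - 1) * path_coeff M m (Suc j) (n - M) else 0)
      + (if m \<le> n then (real m - 1) * path_coeff M m j (n - m) else 0)"
    using Mm by (auto simp: path_coeff_def two_parts_def coeff_1)
qed

text \<open>The coefficient itself is \<open>M (M - 1)^(k - 1)\<close>; the extra factor
  \<open>M - 1\<close> avoids the exponent \<open>k - 1\<close>, here and in
  \<open>path_coeff_1\<close>.\<close>

lemma path_coeff_0_mult:
  assumes "k > 0"
  shows "(real M - 1) * path_coeff M m 0 (k * M) = real M * (real M - 1) ^ k"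
  using assms
proof (induction k rule: nat_induct_non_zero)
  case 1
  then show ?case using M path_coeff_rec(1)[of M] by simp
next
  case (Suc k)
  then show ?case using M path_coeff_rec(1)[of "Suc k * M"] by simp
qed

lemma path_coeff_0_not_dvd: "\<not> M dvd n \<Longrightarrow> path_coeff M m 0 n = 0"
proof (induction n rule: less_induct)
  case (less n)
  then have "n > 0" "n \<noteq> M" by (auto intro: Nat.gr0I)
  moreover have "path_coeff M m 0 (n - M) = 0" if "M \<le> n"
    using less that M \<open>n > 0\<close> by (auto simp: dvd_minus_self)
  ultimately show ?case by (simp add: path_coeff_rec)
qed

lemma path_coeff_less: "n < j * m \<Longrightarrow> path_coeff M m j n = 0"
proof (induction n arbitrary: j rule: less_induct)
  case (less n)
  then obtain i where j: "j = Suc i" by (cases j) auto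
  show ?case
  proof (cases "n = 0")
    case False
    have "path_coeff M m (Suc i) (n - M) = 0"
      using less.IH[of "n - M" "Suc i"] less.prems False M by (simp add: j)
    moreover have "path_coeff M m i (n - m) = 0" if "m \<le> n"
      using less.IH[of "n - m" i] less.prems False m that by (simp add: j)
    moreover have "\<not> (n = m \<and> i = 0)" using less.prems by (auto simp: j)
    ultimately show ?thesis using False by (simp add: j path_coeff_rec)
  qed (simp add: j)
qed

lemma path_coeff_1:
  "(real M - 1) * path_coeff M m 1 (k * M + m) =
     (real M - 1) ^ k * (real M * real k * (real m - 1) + real m * (real M - 1))"
proof (induction k)
  case 0
  \<comment> \<open>A degree below \<open>m\<close> leaves no room for a part \<open>m\<close>; this
    also covers the truncated case \<open>m < M\<close>.\<close>
  have "path_coeff M m (Suc 0) (m - M) = 0" using M m path_coeff_less[of "m - M" 1] by simp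
  then show ?case using m path_coeff_rec(2)[of m 0] by simp
next
  case (Suc k)
  have "path_coeff M m 1 (Suc k * M + m) =
      (real M - 1) * path_coeff M m 1 (k * M + m) + (real m - 1) * path_coeff M m 0 (Suc k * M)"
    using M path_coeff_rec(2)[of "Suc k * M + m" 0] by (simp add: add.assoc)
  then have "(real M - 1) * path_coeff M m 1 (Suc k * M + m) =
      (real M - 1) * ((real M - 1) * path_coeff M m 1 (k * M + m))
        + (real m - 1) * ((real M - 1) * path_coeff M m 0 (Suc k * M))"
    by (simp only: distrib_left) (simp only: mult_ac)
  then show ?case
    unfolding Suc path_coeff_0_mult[OF zero_less_Suc] by (simp add: algebra_simps)
qed

section \<open>Inequalities forced by e-positivity\<close>

text \<open>Both part sizes are at least 2, so the specialization kills \<open>e_1\<close> and with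
  it the middle term of the spider formula.\<close>

lemma e_positive_path_coeff:
  assumes "e_positive (spider_vertices a b 1) (spider_adj a b 1)" "1 \<le> a" "1 \<le> b"
  shows "(\<Sum>i\<le>j. path_coeff M m i (a + 1) * path_coeff M m (j - i) (b + 1)) \<le> path_coeff M m j (a + b + 2)"
proof -
  have "two_parts M m 1 = 0" using M m by (simp add: two_parts_def)
  moreover have "coeff (two_parts M m k) i \<ge> 0" for k i
    by (auto simp: two_parts_def coeff_1)
  ultimately show ?thesis
    using spider_coeff_nonneg[of a b "two_parts M m" j] assms
    by (simp add: path_coeff_def coeff_mult)
qed

text \<open>Compare the coefficients of \<open>e_m e_M^(p + q)\<close>. As \<open>M\<close> does not
  divide \<open>a + 1\<close>, the part \<open>m\<close> must come from the path on
  \<open>a + 1\<close> vertices, so a single product survives.\<close>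

lemma e_positive_one_extra_part:
  assumes "e_positive (spider_vertices a b 1) (spider_adj a b 1)" "1 \<le> a" "1 \<le> b"
    and a: "a + 1 = p * M + m" and b: "b + 1 = q * M" and "\<not> M dvd m"
  shows "int m * (int M - 1) \<le> int M * (int m - 1) * ((int M - 1) * int q - int p)"
proof -
  define r where "r = real M - 1"
  have r: "r > 0" using M by (simp add: r_def)
  have "q > 0" using b by (auto intro: Nat.gr0I)
  have n: "a + b + 2 = (p + q) * M + m" using a b by (simp add: algebra_simps)
  have "\<not> M dvd a + 1" using assms(6) unfolding a by (simp add: dvd_add_right_iff)
  then have "path_coeff M m 1 (a + 1) * path_coeff M m 0 (b + 1) \<le> path_coeff M m 1 (a + b + 2)"
    using e_positive_path_coeff[OF assms(1-3), of 1] path_coeff_0_not_dvd[of "a + 1"] by simp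
  then have "r * r * (path_coeff M m 1 (p * M + m) * path_coeff M m 0 (q * M))
      \<le> r * r * path_coeff M m 1 ((p + q) * M + m)"
    unfolding a b n using r by (intro mult_left_mono) simp_all
  then have "(r * path_coeff M m 1 (p * M + m)) * (r * path_coeff M m 0 (q * M))
      \<le> r * (r * path_coeff M m 1 ((p + q) * M + m))"
    by (simp only: mult_ac)
  then have "r ^ (p + q) * (M * (M * p * (real m - 1) + m * r)) \<le>
     r ^ (p + q) * (r * (M * (p + q) * (real m - 1) + m * r))"
    unfolding r_def path_coeff_1 path_coeff_0_mult[OF \<open>q > 0\<close>] by (simp add: power_add mult_ac)
  then have "M * (M * p * (real m - 1) + m * r) \<le> r * (M * (p + q) * (real m - 1) + m * r)"
    using r by simp
  \<comment> \<open>Collect terms using \<open>M - r = 1\<close>.\<close>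
  then have "m * (real M - 1) \<le> M * (real m - 1) * ((real M - 1) * q - p)"
    unfolding r_def by (simp add: algebra_simps)
  then have "real_of_int (int m * (int M - 1)) \<le> real_of_int (int M * (int m - 1) * ((int M - 1) * int q - int p))"
    by simp
  then show ?thesis by (simp only: of_int_le_iff)
qed

end

text \<open>For \<open>e_M^(p + q)\<close> the product of paths contributes
  \<open>M^2 (M - 1)^(p + q - 2)\<close>, more than the \<open>M (M - 1)^(p + q - 1)\<close> of the
  long path.\<close>

lemma e_positive_not_dvd:
  assumes "e_positive (spider_vertices a b 1) (spider_adj a b 1)" "1 \<le> a" "1 \<le> b" and M: "2 \<le> M"
  shows "\<not> (M dvd a + 1 \<and> M dvd b + 1)"
proof
  assume "M dvd a + 1 \<and> M dvd b + 1"
  then obtain p q where p: "a + 1 = p * M" and q: "b + 1 = q * M"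
    by (metis dvdE mult.commute)
  have pos: "p > 0" "q > 0" using p q by (auto intro: Nat.gr0I)
  define r where "r = real M - 1"
  have r: "r > 0" using M by (simp add: r_def)
  have n: "a + b + 2 = (p + q) * M" using p q by (simp add: algebra_simps)
  \<comment> \<open>\<open>Suc M\<close> is a dummy second part size: only the coefficient of degree
    0 in it is taken.\<close>
  let ?c = "path_coeff M (Suc M) 0"
  have "r * r * (?c (p * M) * ?c (q * M)) \<le> r * r * ?c ((p + q) * M)"
    using e_positive_path_coeff[of M "Suc M", OF _ _ _ assms(1-3), of 0] M r
    unfolding p q n by (intro mult_left_mono) simp_all
  then have "(r * ?c (p * M)) * (r * ?c (q * M)) \<le> r * (r * ?c ((p + q) * M))"
    by (simp only: mult_ac)
  moreover have "r * ?c (k * M) = real M * r ^ k" if "k > 0" for k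
    using path_coeff_0_mult[of M "Suc M" k] M that by (simp add: r_def)
  ultimately have "(real M * r ^ p) * (real M * r ^ q) \<le> r * (real M * r ^ (p + q))"
    using pos by simp
  then have "r ^ (p + q) * (real M * real M) \<le> r ^ (p + q) * (real M * r)"
    by (simp add: power_add mult_ac)
  then have "real M * real M \<le> real M * r" using r by simp
  then show False using M by (simp add: r_def)
qed

text \<open>For \<open>M = 2\<close> the factor \<open>M - 1\<close> is 1, so the recurrence is a
  telescoping sum with increments \<open>2 * (4 k + 3)\<close>.\<close>

lemma path_coeff_2_3: "path_coeff 2 3 2 (2 * k + 6) = (real k + 1) * (4 * real k + 6)"
proof (induction k)
  have one: "path_coeff 2 3 1 (2 * k + 3) = 4 * real k + 3" for k
    using path_coeff_1[of 2 3 k] by (simp add: mult.commute)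
  have rec: "path_coeff 2 3 2 (n + 3) = path_coeff 2 3 2 (n + 1) + 2 * path_coeff 2 3 1 n" for n
    using path_coeff_rec(2)[of 2 3 "n + 3" 1] by (simp add: numeral_2_eq_2)
  {
    case 0
    show ?case using rec[of 3] one[of 0] path_coeff_less[of 2 3 4 2] by simp
  next
    case (Suc k)
    show ?case using rec[of "2 * Suc k + 3"] one[of "Suc k"] Suc by (simp add: algebra_simps)
  }
qed

text \<open>Both \<open>a + 1\<close> and \<open>b + 1\<close> are odd, so each path factor needs an
  odd number of 3s: of the ways to distribute two 3s only one each survives.\<close>

lemma e_positive_even_legs:
  assumes "e_positive (spider_vertices a b 1) (spider_adj a b 1)" "a = 2 * k + 2" "b = 2 * l + 2"
  shows "(4 * int k + 3) * (4 * int l + 3) \<le> (int k + int l + 1) * (4 * (int k + int l) + 6)"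
proof -
  have one: "path_coeff 2 3 1 (2 * k + 3) = 4 * real k + 3" for k
    using path_coeff_1[of 2 3 k] by (simp add: mult.commute)
  have zero: "path_coeff 2 3 0 (2 * k + 3) = 0" for k
    by (rule path_coeff_0_not_dvd) simp_all
  have ab: "a + 1 = 2 * k + 3" "b + 1 = 2 * l + 3" "a + b + 2 = 2 * (k + l) + 6"
    using assms by simp_all
  have "(\<Sum>i\<le>2. path_coeff 2 3 i (a + 1) * path_coeff 2 3 (2 - i) (b + 1)) \<le> path_coeff 2 3 2 (a + b + 2)"
    using assms by (intro e_positive_path_coeff) simp_all
  also have "{..2::nat} = {0, 1, 2}" by auto
  finally have "(4 * real k + 3) * (4 * real l + 3) \<le> (real (k + l) + 1) * (4 * real (k + l) + 6)"
    unfolding ab path_coeff_2_3 using one zero by simp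
  then have "real_of_int ((4 * int k + 3) * (4 * int l + 3))
      \<le> real_of_int ((int k + int l + 1) * (4 * (int k + int l) + 6))"
    by simp
  then show ?thesis by (simp only: of_int_le_iff)
qed

section \<open>Excluding the pairs (a, b)\<close>

theorem theorem3p3:
  fixes a b :: nat
  assumes "even b" and "2 \<le> b" and "b \<le> a"
    and "e_positive (spider_vertices a b 1) (spider_adj a b 1)"
  shows "(b mod 3 = 2 \<longrightarrow>
            (a mod 3 = 0 \<and> a \<le> 2 * b + 2) \<or> (a mod 3 = 1 \<and> a \<le> 2 * b - 3))
       \<and> (b mod 3 \<noteq> 2 \<longrightarrow> a \<le> b ^ 2 - 1 \<or> a = b ^ 2 + b)
       \<and> (even a \<longrightarrow> real a > real b + (1 + sqrt (8 * real b - 3)) / 2)"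
proof (intro conjI impI)
  note pos = assms(4)
  have ab: "1 \<le> a" "1 \<le> b" using assms by simp_all
  show "(a mod 3 = 0 \<and> a \<le> 2 * b + 2) \<or> (a mod 3 = 1 \<and> a \<le> 2 * b - 3)" if "b mod 3 = 2"
  proof -
    have "b + 1 = (b div 3 + 1) * 3" using that by presburger
    then obtain q where q: "b + 1 = q * 3" ..
    consider "a mod 3 = 0" | "a mod 3 = 1" | "a mod 3 = 2" by linarith
    then show ?thesis
    proof cases
      case 1
      \<comment> \<open>Here \<open>a + 1\<close> is 1 modulo 3; the extra part must be at least 2,
        so 4 is taken. The resulting inequality forces \<open>p \<le> 2 q - 1\<close>.\<close>
      have "a + 1 = (a div 3 - 1) * 3 + 4" using 1 assms(2,3) by presburger
      then obtain p where p: "a + 1 = p * 3 + 4" ..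
      have "\<not> 3 dvd (4 :: nat)" by presburger
      then have "8 \<le> 9 * (2 * int q - int p)"
        using e_positive_one_extra_part[OF _ _ _ pos ab p q] by simp
      then have "a \<le> 2 * b + 2" using p q by presburger
      with 1 show ?thesis by simp
    next
      case 2
      have "a + 1 = (a div 3) * 3 + 2" using 2 by presburger
      then obtain p where p: "a + 1 = p * 3 + 2" ..
      have "\<not> 3 dvd (2 :: nat)" by presburger
      \<comment> \<open>By integrality \<open>2 q - p \<ge> 2\<close>, which yields the sharp bound
        \<open>2 b - 3\<close>.\<close>
      then have "4 \<le> 3 * (2 * int q - int p)"
        using e_positive_one_extra_part[OF _ _ _ pos ab p q] by simp
      then have "a \<le> 2 * b - 3" using p q by presburger
      with 2 show ?thesis by simp
    next
      case 3
      then have "3 dvd a + 1 \<and> 3 dvd b + 1" using that by presburger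
      then show ?thesis using e_positive_not_dvd[OF pos ab, of 3] by simp
    qed
  qed
  show "a \<le> b ^ 2 - 1 \<or> a = b ^ 2 + b"
  proof (rule ccontr)
    assume neg: "\<not> (a \<le> b ^ 2 - 1 \<or> a = b ^ 2 + b)"
    then have ge: "b ^ 2 \<le> a" and ne: "a \<noteq> b ^ 2 + b" by auto
    \<comment> \<open>Take \<open>M = b + 1\<close>, so that \<open>q = 1\<close>: \<open>s\<close>
      is the number of parts \<open>M\<close> and the remainder \<open>r\<close> is the candidate
      for the extra part.\<close>
    define s r where "s = (a + 1) div (b + 1)" and "r = (a + 1) mod (b + 1)"
    have sr: "a + 1 = s * (b + 1) + r" unfolding s_def r_def by (rule div_mult_mod_eq[symmetric])
    have rb: "r \<le> b" using mod_less_divisor[of "b + 1" "a + 1"] by (simp add: r_def)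
    have s: "b - 1 \<le> s"
    proof (rule ccontr)
      assume "\<not> b - 1 \<le> s"
      then have "s + 2 \<le> b" by simp
      then have "(s + 2) * (b + 1) \<le> b * (b + 1)" by (rule mult_le_mono1)
      then show False using sr rb ge by (simp add: power2_eq_square)
    qed
    \<comment> \<open>The bound \<open>a \<ge> b^2\<close> reads
      \<open>a + 1 \<ge> (b - 1) (b + 1) + 2\<close>.\<close>
    have s': "b \<le> s \<or> s + 1 = b \<and> 2 \<le> r"
    proof (rule ccontr)
      assume "\<not> ?thesis"
      then have "s + 1 = b" "r \<le> 1" using s assms(2) by auto
      then have "b * (b + 1) = s * (b + 1) + (b + 1)" by (metis add_mult_distrib mult_1)
      then show False using sr \<open>r \<le> 1\<close> ge by (simp add: power2_eq_square)
    qed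
    have q: "b + 1 = 1 * (b + 1)" by simp
    have "r \<noteq> 0" using e_positive_not_dvd[OF pos ab, of "b + 1"] ab by (simp add: r_def dvd_eq_mod_eq_0)
    then consider "2 \<le> r" | "r = 1" by linarith
    then show False
    proof cases
      case 1
      have "\<not> b + 1 dvd r" using 1 rb by (auto dest: dvd_imp_le)
      then have *: "int r * int b \<le> int (b + 1) * (int r - 1) * (int b - int s)"
        using e_positive_one_extra_part[OF _ 1 _ pos ab sr q] rb ab by simp
      show False
      proof (cases "b \<le> s")
        case True
        then have "int (b + 1) * (int r - 1) * (int b - int s) \<le> 0"
          using 1 by (intro mult_nonneg_nonpos) simp_all
        moreover have "int r * int b > 0" using 1 ab by simp
        ultimately show False using * by linarith
      next
        case False
        then have "int b - int s = 1" using s' by linarith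
        \<comment> \<open>Expanding gives \<open>r \<ge> b + 1\<close>, impossible for a
          remainder.\<close>
        with * have "int r * int b \<le> int (b + 1) * (int r - 1)" by (simp only: mult_1_right)
        then show False using rb by (simp add: algebra_simps)
      qed
    next
      case 2
      \<comment> \<open>With \<open>r = 1\<close>, the case \<open>s = b\<close> is exactly the
        exceptional value \<open>a = b^2 + b\<close>. Otherwise, as 1 is not an admissible extra
        part, one block is merged with it: \<open>m = b + 2\<close> and
        \<open>p = s - 1 \<ge> b\<close>.\<close>
      have "s \<noteq> b" using 2 ne sr by (auto simp: power2_eq_square)
      then have "b + 1 \<le> s" using s' 2 by linarith
      then obtain t where t: "s = Suc t" "b \<le> t" by (cases s) auto
      have p: "a + 1 = t * (b + 1) + (b + 2)" using sr 2 t by simp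
      have "\<not> b + 1 dvd b + 2"
      proof
        assume "b + 1 dvd b + 2"
        then have "b + 1 dvd (b + 2) - (b + 1)" by (rule dvd_diff_nat) simp
        then show False using ab by simp
      qed
      then have "int (b + 2) * int b \<le> int (b + 1) * (int (b + 2) - 1) * (int b - int t)"
        using e_positive_one_extra_part[OF _ _ _ pos ab p q] ab by simp
      moreover have "int (b + 1) * (int (b + 2) - 1) * (int b - int t) \<le> 0"
        using t by (intro mult_nonneg_nonpos) simp_all
      moreover have "int (b + 2) * int b > 0" using ab by simp
      ultimately show False by linarith
    qed
  qed
  show "real a > real b + (1 + sqrt (8 * real b - 3)) / 2" if "even a"
  proof -
    have "b = 2 * (b div 2 - 1) + 2" using assms(1,2) by presburger
    then obtain l where l: "b = 2 * l + 2" ..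
    have "a = b + 2 * ((a - b) div 2)" using assms(1,3) that by presburger
    then obtain d where d: "a = b + 2 * d" ..
    have "(4 * int (l + d) + 3) * (4 * int l + 3) \<le>
        (int (l + d) + int l + 1) * (4 * (int (l + d) + int l) + 6)"
      by (rule e_positive_even_legs[OF pos]) (use l d in simp_all)
    then have "4 * int l + 3 + 2 * int d \<le> 4 * (int d * int d)"
      by (simp add: algebra_simps)
    \<comment> \<open>Parity: the left side was odd and the right side is even, so the inequality
      gains 1.\<close>
    then have "4 * int l + 4 + 2 * int d \<le> 4 * (int d * int d)" by presburger
    then have D: "2 * int b + 2 * int d \<le> 4 * (int d * int d)" by (simp add: l)
    then have "real_of_int (2 * int b + 2 * int d) \<le> real_of_int (4 * (int d * int d))"
      by (simp only: of_int_le_iff)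
    \<comment> \<open>Four times the previous bound completes to the square
      \<open>16 d^2 - 8 d + 1 \<ge> 8 b + 1\<close>.\<close>
    then have "8 * real b - 3 < (4 * real d - 1)\<^sup>2"
      by (simp add: power2_eq_square algebra_simps)
    moreover have "d > 0" using D ab by (auto intro: Nat.gr0I)
    ultimately have "sqrt (8 * real b - 3) < 4 * real d - 1"
      by (intro real_less_lsqrt) simp_all
    then show ?thesis by (simp add: d)
  qed
qed
end
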